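(* Let $A=(a_{i,j})_{1\le i\le m,\,1\le j\le n}$ be an $m\times n$ matrix over a commutative ring with unity, $m\le n$, let $1\le k\le m-1$ and $\bar\beta\in Q_{k,m}$. Then $$\mathrm{per}(z;A)=\sum_{\varphi\in\mathrm{Inj}(\{\bar\beta\},N_n)}z^{|\varphi|}\Big(\prod_{i\in\{\bar\beta\}}a_{i,\varphi(i)}\Big)\,\mathrm{per}\big(z;A[N_m\setminus\{\bar\beta\}\,|\,\bar\varphi(N_n)]\big).$$
   Context: $N_n=\{1,\dots,n\}$; $Q_{k,m}$ is the set of strictly increasing sequences of length $k$ with entries in $N_m$, and $\{\bar\beta\}$ is the set of entries of $\bar\beta$. For $S\subseteq N_n$, $\mathrm{Inj}(S,N_n)$ is the set of injective maps $S\to N_n$; for $\varphi\in\mathrm{Inj}(S,N_n)$, $|\varphi|$ is the number of cycles of $\varphi$, i.e. the number of nonempty sets $C\subseteq S$ of the form $\{j,\varphi(j),\dots,\varphi^{p-1}(j)\}$ with $\varphi^p(j)=j$. For a $p\times q$ matrix $B=(b_{i,j})$, $p\le q$, the cyclic permanent is $\mathrm{per}(z;B)=\sum_{\varphi\in\mathrm{Inj}(N_p,N_q)}z^{|\varphi|}\prod_{i=1}^p b_{i,\varphi(i)}$. For a set $T$ of row indices and a sequence $(c_1,\dots,c_q)$ of column indices, $A[T\,|\,c_1,\dots,c_q]$ is the matrix formed by the rows of $A$ indexed by $T$ in increasing order whose $s$-th column is column $c_s$ of $A$, re-indexed by $1,2,\dots$ in rows and columns. For $S\subseteq N_n$ and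 $\varphi\in\mathrm{Inj}(S,N_n)$ define $\varphi^*:\varphi(S)\setminus S\to S\setminus\varphi(S)$ by: for $j\in\varphi(S)\setminus S$, $j_0=j$, $j_l=\varphi^{-1}(j_{l-1})$ while $j_{l-1}\in\varphi(S)$, and $\varphi^*(j)$ is the first $j_l$ lying in $S\setminus\varphi(S)$. For a sequence $(x_1,\dots,x_n)$, $\bar\varphi(x_1,\dots,x_n)$ is $(y_j)_{j\in N_n\setminus S}$ in increasing order of $j$, with $y_j=x_j$ if $j\notin\varphi(S)$ and $y_j=x_{\varphi^*(j)}$ if $j\in\varphi(S)\setminus S$; $\bar\varphi(N_n)=\bar\varphi(1,\dots,n)$. *)

theory Defs
  imports "HOL-Library.FuncSet" "Jordan_Normal_Form.Matrix"
begin

text \<open>Matrices and lists are indexed from 0, so the index set \<open>N\<^sub>n\<close> is \<open>{..<n}\<close> throughout.\<close>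

definition N :: "nat \<Rightarrow> nat set" where
  "N n = {..<n}"

definition Q :: "nat \<Rightarrow> nat \<Rightarrow> nat list set" where
  "Q k m = {\<beta>. length \<beta> = k \<and> sorted_wrt (<) \<beta> \<and> set \<beta> \<subseteq> N m}"

text \<open>Maps on \<open>S\<close> are extensional (equal to \<^const>\<open>undefined\<close> off \<open>S\<close>), so each is counted once.\<close>

definition Inj :: "'b set \<Rightarrow> 'c set \<Rightarrow> ('b \<Rightarrow> 'c) set" where
  "Inj S T = {\<phi> \<in> S \<rightarrow>\<^sub>E T. inj_on \<phi> S}"

text \<open>\<open>C \<subseteq> S\<close> ensures that \<open>\<phi>\<close> is iterated only inside its domain \<open>S\<close>.\<close>

definition cycles_on :: "'b set \<Rightarrow> ('b \<Rightarrow> 'b) \<Rightarrow> 'b set set" where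
  "cycles_on S \<phi> = {C. C \<noteq> {} \<and> C \<subseteq> S \<and>
     (\<exists>j p. C = (\<lambda>l. (\<phi> ^^ l) j) ` {..<p} \<and> (\<phi> ^^ p) j = j)}"

definition num_cycles :: "'b set \<Rightarrow> ('b \<Rightarrow> 'b) \<Rightarrow> nat" where
  "num_cycles S \<phi> = card (cycles_on S \<phi>)"

definition cyc_per :: "'a::comm_ring_1 \<Rightarrow> 'a mat \<Rightarrow> 'a" where
  "cyc_per z B = (\<Sum>\<phi>\<in>Inj (N (dim_row B)) (N (dim_col B)).
     z ^ num_cycles (N (dim_row B)) \<phi> * (\<Prod>i\<in>N (dim_row B). B $$ (i, \<phi> i)))"

definition select_mat :: "'a mat \<Rightarrow> nat set \<Rightarrow> nat list \<Rightarrow> 'a mat" where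
  "select_mat A T cs =
     mat (card T) (length cs) (\<lambda>(r, s). A $$ (sorted_list_of_set T ! r, cs ! s))"

text \<open>
  Meant for \<open>j \<in> \<phi> ` S - S\<close>. Before the backward orbit of such a \<open>j\<close> first meets
  \<open>S - \<phi> ` S\<close> it stays in \<open>\<phi> ` S\<close> (its later members lie in \<open>S\<close>), so \<^const>\<open>inv_into\<close> is
  applied only where \<open>\<phi>\<close> has a preimage in \<open>S\<close>.
\<close>

definition star_map :: "'b set \<Rightarrow> ('b \<Rightarrow> 'b) \<Rightarrow> 'b \<Rightarrow> 'b" where
  "star_map S \<phi> j =
     (inv_into S \<phi> ^^ (LEAST l. (inv_into S \<phi> ^^ l) j \<in> S - \<phi> ` S)) j"

definition bar_map :: "nat set \<Rightarrow> (nat \<Rightarrow> nat) \<Rightarrow> 'b list \<Rightarrow> 'b list" where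
  "bar_map S \<phi> xs =
     map (\<lambda>j. if j \<in> \<phi> ` S then xs ! star_map S \<phi> j else xs ! j)
       (sorted_list_of_set (N (length xs) - S))"

end

theory Submission
  imports Defs "HOL-Combinatorics.Orbits"
begin

text \<open>
  Group the maps \<open>\<psi>\<close> counted by \<open>per(z; A)\<close> by their restriction \<open>\<phi>\<close> to \<open>S = {\<beta>}\<close>. For fixed \<open>\<phi>\<close>, the
  map \<open>j \<mapsto> y\<^sub>j\<close> of \<open>\<phi>\<close>-bar is a bijection from \<open>N\<^sub>n - S\<close> onto \<open>N\<^sub>n - \<phi>(S)\<close>, so the restriction of \<open>\<psi>\<close> to
  \<open>N\<^sub>m - S\<close> is \<open>i \<mapsto> y\<^bsub>\<sigma>(i)\<^esub>\<close> for a unique injection \<open>\<sigma>\<close> into \<open>N\<^sub>n - S\<close>. Starting from \<open>y\<^sub>j\<close>, iterating \<open>\<phi>\<close> runs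
  through \<open>S\<close> until it leaves at \<open>j\<close>; hence \<open>\<sigma>\<close> is the first-return map of \<open>\<psi>\<close> to the complement of
  \<open>S\<close>, and its cycles correspond to the cycles of \<open>\<psi>\<close> that are not contained in \<open>S\<close>.
\<close>

section \<open>Cycles as orbits, relabelling, and first-return maps\<close>

text \<open>Since \<open>orbit\<close> begins at \<open>\<phi> j\<close> rather than at
  \<open>j\<close>, the condition \<open>j \<in> orbit \<phi> j\<close> says exactly that
  \<open>j\<close> is periodic. Nonemptiness of \<open>C\<close> excludes \<open>p = 0\<close> in
  \<open>cycles_on\<close>.\<close>

lemma cycles_on_orbit:
  "cycles_on S \<phi> = {orbit \<phi> j | j. j \<in> orbit \<phi> j \<and> orbit \<phi> j \<subseteq> S}"
proof (intro equalityI subsetI)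
  fix C assume "C \<in> cycles_on S \<phi>"
  then obtain j p where C: "C \<noteq> {}" "C \<subseteq> S" "C = (\<lambda>l. (\<phi> ^^ l) j) ` {..<p}"
      "(\<phi> ^^ p) j = j"
    by (auto simp: cycles_on_def)
  then have p: "0 < p" by (cases p) auto
  then have "orbit \<phi> j = C" using orbit_altdef_bounded[OF C(4)] C(3) by auto
  moreover have "j \<in> orbit \<phi> j" using C(4) p by (metis (mono_tags, lifting) mem_Collect_eq orbit_altdef)
  ultimately show "C \<in> {orbit \<phi> j | j. j \<in> orbit \<phi> j \<and> orbit \<phi> j \<subseteq> S}"
    using C(2) by blast
next
  fix C assume "C \<in> {orbit \<phi> j | j. j \<in> orbit \<phi> j \<and> orbit \<phi> j \<subseteq> S}"
  then obtain j where j: "C = orbit \<phi> j" "j \<in> orbit \<phi> j" "orbit \<phi> j \<subseteq> S" by blast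
  then obtain p where p: "(\<phi> ^^ p) j = j" "0 < p"
    unfolding orbit_altdef by auto metis
  then have "C = (\<lambda>l. (\<phi> ^^ l) j) ` {..<p}" using orbit_altdef_bounded[OF p] j(1) by auto
  then show "C \<in> cycles_on S \<phi>"
    using j p orbit_nonempty[of \<phi> j] unfolding cycles_on_def by blast
qed

lemma self_in_orbit_eq:
  assumes "s \<in> orbit f s" and "t \<in> orbit f s"
  shows "orbit f t = orbit f s"
  using assms orbit_swap orbit_trans by (metis subset_antisym subsetI)

text \<open>Induction along each orbit. The point \<open>x\<close> is inserted because
  \<open>orbit \<tau> x\<close> starts at \<open>\<tau> x\<close>. Asking for the equation along one
  orbit only makes this usable for maps that are intertwined merely on a subset.\<close>

lemma orbit_relabel:
  assumes "\<And>y. y \<in> insert x (orbit \<tau> x) \<Longrightarrow> \<sigma> (h y) = h (\<tau> y)"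
  shows "orbit \<sigma> (h x) = h ` orbit \<tau> x"
proof (intro equalityI subsetI)
  fix y assume "y \<in> orbit \<sigma> (h x)"
  then show "y \<in> h ` orbit \<tau> x"
  proof induction
    case base
    show ?case using assms[of x] by (auto intro: orbit.base)
  next
    case (step y)
    then show ?case using assms by (auto intro: orbit.step)
  qed
next
  fix y assume "y \<in> h ` orbit \<tau> x"
  then obtain w where "w \<in> orbit \<tau> x" "y = h w" by blast
  then show "y \<in> orbit \<sigma> (h x)"
  proof (induction arbitrary: y)
    case base
    then show ?case using assms[of x] by (metis insertI1 orbit.base)
  next
    case (step w)
    then show ?case using assms[of w] by (metis insertI2 orbit.step)
  qed
qed

text \<open>Taking images under \<open>h\<close> matches the cycles. Injectivity must also cover the
  image of \<open>P\<close> under \<open>\<tau>\<close>: pulling a cycle back compares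
  \<open>h (\<tau> y)\<close> with some \<open>h w\<close>, \<open>w \<in> P\<close>, before
  \<open>\<tau> y \<in> P\<close> is known.\<close>

lemma num_cycles_relabel:
  assumes inj: "inj_on h (P \<union> \<tau> ` P)"
    and eq: "\<And>x. x \<in> P \<Longrightarrow> \<sigma> (h x) = h (\<tau> x)"
  shows "num_cycles (h ` P) \<sigma> = num_cycles P \<tau>"
proof -
  have "cycles_on (h ` P) \<sigma> = (`) h ` cycles_on P \<tau>"
  proof (intro equalityI subsetI)
    fix C assume "C \<in> (`) h ` cycles_on P \<tau>"
    then obtain j where j: "j \<in> orbit \<tau> j" "orbit \<tau> j \<subseteq> P" "C = h ` orbit \<tau> j"
      by (auto simp: cycles_on_orbit)
    then have "orbit \<sigma> (h j) = h ` orbit \<tau> j" by (intro orbit_relabel eq) auto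
    then show "C \<in> cycles_on (h ` P) \<sigma>"
      using j unfolding cycles_on_orbit by blast
  next
    fix C assume "C \<in> cycles_on (h ` P) \<sigma>"
    then obtain c where c: "c \<in> orbit \<sigma> c" "orbit \<sigma> c \<subseteq> h ` P" "C = orbit \<sigma> c"
      by (auto simp: cycles_on_orbit)
    then obtain j where j: "j \<in> P" "c = h j" by blast
    have sub: "y \<in> P \<and> h y \<in> orbit \<sigma> c" if "y \<in> orbit \<tau> j" for y
      using that
    proof induction
      case base
      have 1: "h (\<tau> j) \<in> orbit \<sigma> c" using j eq by (metis orbit.base)
      then obtain w where "w \<in> P" "h (\<tau> j) = h w" using c(2) by blast
      then have "\<tau> j = w" using inj_onD[OF inj] j(1) by blast
      then show ?case using 1 \<open>w \<in> P\<close> by simp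
    next
      case (step y)
      have 1: "h (\<tau> y) \<in> orbit \<sigma> c" using step eq by (metis orbit.step)
      then obtain w where "w \<in> P" "h (\<tau> y) = h w" using c(2) by blast
      then have "\<tau> y = w" using inj_onD[OF inj] step by blast
      then show ?case using 1 \<open>w \<in> P\<close> by simp
    qed
    then have o: "orbit \<sigma> (h j) = h ` orbit \<tau> j" using j by (intro orbit_relabel eq) auto
    then obtain w where w: "w \<in> orbit \<tau> j" "h j = h w" using c j by blast
    then have "j = w" using inj_onD[OF inj] j(1) sub by blast
    then have "j \<in> orbit \<tau> j" using w by simp
    then have "orbit \<tau> j \<in> cycles_on P \<tau>" using sub unfolding cycles_on_orbit by blast
    then show "C \<in> (`) h ` cycles_on P \<tau>" using o c(3) j(2) by blast
  qed
  moreover have "inj_on ((`) h) (cycles_on P \<tau>)"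
    using inj by (intro inj_on_image) (auto simp: cycles_on_def intro: inj_on_subset)
  ultimately show ?thesis by (simp add: num_cycles_def card_image)
qed

lemma num_cycles_cong:
  assumes "\<And>x. x \<in> S \<Longrightarrow> \<phi> x = \<psi> x"
  shows "num_cycles S \<phi> = num_cycles S \<psi>"
  using num_cycles_relabel[of "\<lambda>x. x" S \<psi> \<phi>] assms by (simp add: inj_on_def)

text \<open>A cycle of \<open>\<psi>\<close> either stays in \<open>S\<close> or is determined by its trace outside \<open>S\<close>, which is a
  cycle of the first-return map \<open>\<sigma>\<close>.\<close>

lemma num_cycles_first_return:
  assumes fin: "finite S" "finite T" and disj: "S \<inter> T = {}"
    and out: "\<And>i. i \<in> T \<Longrightarrow> \<sigma> i \<notin> S"
    and ret: "\<And>i. i \<in> T \<Longrightarrow> \<exists>p. (\<psi> ^^ p) (\<psi> i) = \<sigma> i \<and> (\<forall>l<p. (\<psi> ^^ l) (\<psi> i) \<in> S)"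
  shows "num_cycles (S \<union> T) \<psi> = num_cycles S \<psi> + num_cycles T \<sigma>"
proof -
  \<comment> \<open>\<open>p i\<close> is the number of steps the orbit still takes after
    \<open>\<psi> i\<close> to leave \<open>S\<close> and reach \<open>\<sigma> i\<close>.\<close>
  obtain p where p: "\<And>i. i \<in> T \<Longrightarrow> (\<psi> ^^ p i) (\<psi> i) = \<sigma> i"
    "\<And>i l. i \<in> T \<Longrightarrow> l < p i \<Longrightarrow> (\<psi> ^^ l) (\<psi> i) \<in> S"
    using ret by metis
  have \<sigma>_in: "\<sigma> i \<in> orbit \<psi> i" if "i \<in> T" for i
    using p(1)[OF that] by (metis funpow_in_orbit orbit.base)
  have sub1: "orbit \<sigma> i \<subseteq> orbit \<psi> i" if "i \<in> T" "orbit \<sigma> i \<subseteq> T" for i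
  proof
    fix y assume "y \<in> orbit \<sigma> i"
    then show "y \<in> orbit \<psi> i"
    proof induction
      case base
      show ?case using \<sigma>_in that(1) .
    next
      case (step y)
      then have "y \<in> T" using that(2) by blast
      then show ?case using \<sigma>_in orbit_trans step.IH by metis
    qed
  qed
  \<comment> \<open>Return points avoid \<open>S\<close> by \<open>out\<close>, so if the
    \<open>\<psi>\<close>-orbit stays in \<open>S \<union> T\<close>, each of them lies in
    \<open>T\<close>, where the next excursion starts.\<close>
  have sub2: "orbit \<sigma> i \<subseteq> T" if "i \<in> T" "orbit \<psi> i \<subseteq> S \<union> T" for i
  proof -
    have "y \<in> T \<and> y \<in> orbit \<psi> i" if "y \<in> orbit \<sigma> i" for y
      using that
    proof induction
      case base
      show ?case using \<sigma>_in[OF \<open>i \<in> T\<close>] out[OF \<open>i \<in> T\<close>] \<open>orbit \<psi> i \<subseteq> S \<union> T\<close> by blast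
    next
      case (step y)
      then have "\<sigma> y \<in> orbit \<psi> i" using \<sigma>_in orbit_trans by metis
      then show ?case using step out[of y] \<open>orbit \<psi> i \<subseteq> S \<union> T\<close> by blast
    qed
    then show ?thesis by blast
  qed
  have sub3: "orbit \<psi> i \<subseteq> S \<union> orbit \<sigma> i" if "i \<in> T" "orbit \<sigma> i \<subseteq> T" for i
  proof -
    \<comment> \<open>The \<open>\<psi>\<close>-orbit decomposes into excursions: each point is
      reached \<open>l\<close> steps after \<open>\<psi> t\<close> for a starting point
      \<open>t\<close>. At \<open>l = p t\<close> the excursion ends in \<open>\<sigma> t\<close>,
      which starts the next one.\<close>
    have "\<exists>t l. t \<in> insert i (orbit \<sigma> i) \<and> l \<le> p t \<and> y = (\<psi> ^^ l) (\<psi> t)"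
      if "y \<in> orbit \<psi> i" for y
      using that
    proof induction
      case base
      have "\<psi> i = (\<psi> ^^ 0) (\<psi> i)" by simp
      then show ?case by blast
    next
      case (step y)
      then obtain t l where t: "t \<in> insert i (orbit \<sigma> i)" "l \<le> p t" "y = (\<psi> ^^ l) (\<psi> t)"
        by blast
      have tT: "t \<in> T" using t(1) \<open>i \<in> T\<close> \<open>orbit \<sigma> i \<subseteq> T\<close> by blast
      show ?case
      proof (cases "l = p t")
        case True
        then have "y = \<sigma> t" using p(1)[OF tT] t(3) by simp
        then have "y \<in> orbit \<sigma> i" using t(1) by (auto intro: orbit.intros)
        moreover have "\<psi> y = (\<psi> ^^ 0) (\<psi> y)" by simp
        ultimately show ?thesis by blast
      next
        case False
        then have "Suc l \<le> p t" using t(2) by simp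
        moreover have "\<psi> y = (\<psi> ^^ Suc l) (\<psi> t)" using t(3) by simp
        ultimately show ?thesis using t(1) by blast
      qed
    qed
    moreover have "(\<psi> ^^ l) (\<psi> t) \<in> S \<union> orbit \<sigma> i" if "t \<in> insert i (orbit \<sigma> i)" "l \<le> p t" for t l
    proof -
      have tT: "t \<in> T" using that(1) \<open>i \<in> T\<close> \<open>orbit \<sigma> i \<subseteq> T\<close> by blast
      have "\<sigma> t \<in> orbit \<sigma> i" using that(1) by (auto intro: orbit.intros)
      then show ?thesis using p[OF tT] that(2) by (cases "l = p t") auto
    qed
    ultimately show ?thesis by blast
  qed
  have trace: "orbit \<psi> i - S = orbit \<sigma> i" "i \<in> orbit \<psi> i \<longleftrightarrow> i \<in> orbit \<sigma> i"
    "orbit \<psi> i \<subseteq> S \<union> T" if "i \<in> T" "orbit \<sigma> i \<subseteq> T" for i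
    using sub1[OF that] sub3[OF that] that disj by blast+
  \<comment> \<open>\<open>?R\<close> consists of the cycles of \<open>\<psi>\<close> that meet
    \<open>T\<close>; deleting \<open>S\<close> from each will be a bijection onto the cycles of
    \<open>\<sigma>\<close>.\<close>
  let ?R = "cycles_on (S \<union> T) \<psi> - cycles_on S \<psi>"
  have R: "?R = {orbit \<psi> i | i. i \<in> T \<and> i \<in> orbit \<sigma> i \<and> orbit \<sigma> i \<subseteq> T}"
  proof (intro equalityI subsetI)
    fix C assume "C \<in> ?R"
    then obtain j where j: "C = orbit \<psi> j" "j \<in> orbit \<psi> j" "orbit \<psi> j \<subseteq> S \<union> T" "\<not> orbit \<psi> j \<subseteq> S"
      unfolding cycles_on_orbit by blast
    then obtain i where i: "i \<in> T" "i \<in> orbit \<psi> j" by blast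
    then have "orbit \<psi> i = C" using self_in_orbit_eq[OF j(2)] j(1) by blast
    then show "C \<in> {orbit \<psi> i | i. i \<in> T \<and> i \<in> orbit \<sigma> i \<and> orbit \<sigma> i \<subseteq> T}"
      using i j sub2[of i] trace[of i] by blast
  next
    fix C assume "C \<in> {orbit \<psi> i | i. i \<in> T \<and> i \<in> orbit \<sigma> i \<and> orbit \<sigma> i \<subseteq> T}"
    then obtain i where i: "C = orbit \<psi> i" "i \<in> T" "i \<in> orbit \<sigma> i" "orbit \<sigma> i \<subseteq> T" by blast
    then have "i \<in> C" "C \<subseteq> S \<union> T" using trace[of i] by auto
    moreover have "C \<notin> cycles_on S \<psi>"
      using \<open>i \<in> C\<close> i(2) disj unfolding cycles_on_def by blast
    ultimately show "C \<in> ?R" using i(1) unfolding cycles_on_orbit by blast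
  qed
  have "(\<lambda>C. C - S) ` ?R = cycles_on T \<sigma>"
  proof (intro equalityI subsetI)
    fix D assume "D \<in> (\<lambda>C. C - S) ` ?R"
    then obtain i where "D = orbit \<psi> i - S" "i \<in> T" "i \<in> orbit \<sigma> i" "orbit \<sigma> i \<subseteq> T"
      unfolding R by blast
    then show "D \<in> cycles_on T \<sigma>" using trace[of i] unfolding cycles_on_orbit by blast
  next
    fix D assume "D \<in> cycles_on T \<sigma>"
    then obtain i where i: "D = orbit \<sigma> i" "i \<in> orbit \<sigma> i" "orbit \<sigma> i \<subseteq> T"
      unfolding cycles_on_orbit by blast
    then have "i \<in> T" by blast
    then have "orbit \<psi> i \<in> ?R" "D = orbit \<psi> i - S" using i trace[of i] unfolding R by blast+
    then show "D \<in> (\<lambda>C. C - S) ` ?R" by blast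
  qed
  moreover have "inj_on (\<lambda>C. C - S) ?R"
  proof (rule inj_onI)
    fix C D assume "C \<in> ?R" "D \<in> ?R" and eq: "C - S = D - S"
    then obtain i j where i: "C = orbit \<psi> i" "i \<in> T" "i \<in> orbit \<sigma> i" "orbit \<sigma> i \<subseteq> T"
      and j: "D = orbit \<psi> j" "j \<in> T" "j \<in> orbit \<sigma> j" "orbit \<sigma> j \<subseteq> T"
      unfolding R by blast
    then have "i \<in> orbit \<psi> j" "j \<in> orbit \<psi> j" using eq trace[of i] trace[of j] by blast+
    then show "C = D" using self_in_orbit_eq[of j \<psi> i] i(1) j(1) by simp
  qed
  ultimately have "card ?R = num_cycles T \<sigma>"
    unfolding num_cycles_def using card_image[of "\<lambda>C. C - S" ?R] by simp
  moreover have "cycles_on S \<psi> \<subseteq> cycles_on (S \<union> T) \<psi>" unfolding cycles_on_def by blast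
  moreover have "finite (cycles_on (S \<union> T) \<psi>)"
    by (rule finite_subset[of _ "Pow (S \<union> T)"]) (use fin in \<open>auto simp: cycles_on_def\<close>)
  ultimately show ?thesis
    using card_Diff_subset[of "cycles_on S \<psi>" "cycles_on (S \<union> T) \<psi>"]
      card_mono[of "cycles_on (S \<union> T) \<psi>" "cycles_on S \<psi>"]
      finite_subset[of "cycles_on S \<psi>" "cycles_on (S \<union> T) \<psi>"]
    unfolding num_cycles_def by linarith
qed

section \<open>Splitting and reindexing sums over injections\<close>

lemma finite_Inj: "finite S \<Longrightarrow> finite U \<Longrightarrow> finite (Inj S U)"
  unfolding Inj_def by (simp add: finite_PiE)

text \<open>An injection on \<open>S \<union> T\<close> is a pair of injections with disjoint
  images, so \<open>\<chi>\<close> has to avoid the values of \<open>\<phi>\<close>. Extensionality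
  makes restricting and gluing mutually inverse.\<close>

lemma sum_Inj_Un:
  assumes disj: "S \<inter> T = {}" and fin: "finite S" "finite T" "finite U"
  shows "sum f (Inj (S \<union> T) U) =
    (\<Sum>\<phi>\<in>Inj S U. \<Sum>\<chi>\<in>Inj T (U - \<phi> ` S). f (\<lambda>i. if i \<in> S then \<phi> i else \<chi> i))"
proof -
  have "sum f (Inj (S \<union> T) U) =
    (\<Sum>(\<phi>, \<chi>)\<in>(SIGMA \<phi>:Inj S U. Inj T (U - \<phi> ` S)). f (\<lambda>i. if i \<in> S then \<phi> i else \<chi> i))"
  proof (rule sum.reindex_bij_witness[where
        i = "\<lambda>(\<phi>, \<chi>). \<lambda>i. if i \<in> S then \<phi> i else \<chi> i" and
        j = "\<lambda>\<psi>. (restrict \<psi> S, restrict \<psi> T)"])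
    fix \<psi> assume \<psi>: "\<psi> \<in> Inj (S \<union> T) U"
    then show "(case (restrict \<psi> S, restrict \<psi> T) of (\<phi>, \<chi>) \<Rightarrow> \<lambda>i. if i \<in> S then \<phi> i else \<chi> i) = \<psi>"
      by (auto simp: Inj_def fun_eq_iff PiE_def extensional_def)
    then show "(case (restrict \<psi> S, restrict \<psi> T) of (\<phi>, \<chi>) \<Rightarrow> f (\<lambda>i. if i \<in> S then \<phi> i else \<chi> i)) = f \<psi>"
      by simp
    show "(restrict \<psi> S, restrict \<psi> T) \<in> (SIGMA \<phi>:Inj S U. Inj T (U - \<phi> ` S))"
      using \<psi> disj by (auto simp: Inj_def inj_on_def)
  next
    fix p assume p: "p \<in> (SIGMA \<phi>:Inj S U. Inj T (U - \<phi> ` S))"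
    obtain \<phi> \<chi> where [simp]: "p = (\<phi>, \<chi>)" by (cases p)
    show "(\<lambda>\<psi>. (restrict \<psi> S, restrict \<psi> T)) (case p of (\<phi>, \<chi>) \<Rightarrow> \<lambda>i. if i \<in> S then \<phi> i else \<chi> i) = p"
      using p disj by (auto simp: Inj_def fun_eq_iff PiE_def extensional_def)
    show "(case p of (\<phi>, \<chi>) \<Rightarrow> \<lambda>i. if i \<in> S then \<phi> i else \<chi> i) \<in> Inj (S \<union> T) U"
    proof -
      have "inj_on (\<lambda>i. if i \<in> S then \<phi> i else \<chi> i) (S \<union> T)"
      proof (rule inj_onI)
        fix x y assume "x \<in> S \<union> T" "y \<in> S \<union> T"
          and "(if x \<in> S then \<phi> x else \<chi> x) = (if y \<in> S then \<phi> y else \<chi> y)"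
        moreover have "inj_on \<phi> S" "inj_on \<chi> T" using p by (auto simp: Inj_def)
        moreover have "\<chi> i \<notin> \<phi> ` S" if "i \<in> T" for i using p that by (auto simp: Inj_def)
        ultimately show "x = y"
          by (cases "x \<in> S"; cases "y \<in> S") (simp_all add: inj_on_eq_iff image_iff, metis+)
      qed
      then show ?thesis using p disj by (auto simp: Inj_def PiE_def extensional_def Pi_def)
    qed
  qed
  also have "\<dots> = (\<Sum>\<phi>\<in>Inj S U. \<Sum>\<chi>\<in>Inj T (U - \<phi> ` S). f (\<lambda>i. if i \<in> S then \<phi> i else \<chi> i))"
    using fin by (intro sum.Sigma[symmetric]) (auto intro: finite_Inj)
  finally show ?thesis .
qed

text \<open>Change of variables in which \<open>\<chi>\<close> is \<open>b\<close> after
  \<open>\<tau>\<close> after the inverse of \<open>a\<close>; the restriction to \<open>T\<close>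
  keeps it extensional. It serves to replace sets of rows and columns by initial segments.\<close>

lemma sum_Inj_relabel:
  assumes a: "bij_betw a P T" and b: "bij_betw b W V"
  shows "sum g (Inj T V) = (\<Sum>\<tau>\<in>Inj P W. g (\<lambda>x\<in>T. b (\<tau> (inv_into P a x))))"
proof (rule sum.reindex_bij_witness[where
      i = "\<lambda>\<tau>. \<lambda>x\<in>T. b (\<tau> (inv_into P a x))" and
      j = "\<lambda>\<chi>. \<lambda>r\<in>P. inv_into W b (\<chi> (a r))"])
  have aP: "a r \<in> T" "inv_into P a (a r) = r" if "r \<in> P" for r
    using a that by (auto simp: bij_betw_def)
  have aT: "inv_into P a x \<in> P" "a (inv_into P a x) = x" if "x \<in> T" for x
    using a that by (auto simp: bij_betw_def inv_into_into f_inv_into_f)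
  have bV: "inv_into W b x \<in> W" "b (inv_into W b x) = x" if "x \<in> V" for x
    using b that by (auto simp: bij_betw_def inv_into_into f_inv_into_f)
  fix \<chi> assume \<chi>: "\<chi> \<in> Inj T V"
  then have \<chi>V: "\<chi> x \<in> V" if "x \<in> T" for x using that by (auto simp: Inj_def)
  show e: "(\<lambda>x\<in>T. b ((\<lambda>r\<in>P. inv_into W b (\<chi> (a r))) (inv_into P a x))) = \<chi>"
    using \<chi> by (auto simp: fun_eq_iff aT bV \<chi>V Inj_def PiE_def extensional_def)
  show "g (\<lambda>x\<in>T. b ((\<lambda>r\<in>P. inv_into W b (\<chi> (a r))) (inv_into P a x))) = g \<chi>"
    unfolding e ..
  show "(\<lambda>r\<in>P. inv_into W b (\<chi> (a r))) \<in> Inj P W"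
  proof -
    have "inj_on (\<lambda>r\<in>P. inv_into W b (\<chi> (a r))) P"
    proof (rule inj_onI)
      fix r s assume rs: "r \<in> P" "s \<in> P"
        and "(\<lambda>r\<in>P. inv_into W b (\<chi> (a r))) r = (\<lambda>r\<in>P. inv_into W b (\<chi> (a r))) s"
      then have "b (inv_into W b (\<chi> (a r))) = b (inv_into W b (\<chi> (a s)))" by simp
      then have "\<chi> (a r) = \<chi> (a s)" using rs by (simp add: aP bV \<chi>V)
      then have "a r = a s" using \<chi> rs aP by (auto simp: Inj_def dest: inj_onD)
      then show "r = s" using rs aP(2) by metis
    qed
    then show ?thesis by (simp add: Inj_def aP bV \<chi>V)
  qed
next
  have aP: "a r \<in> T" "inv_into P a (a r) = r" if "r \<in> P" for r
    using a that by (auto simp: bij_betw_def)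
  have aT: "inv_into P a x \<in> P" "a (inv_into P a x) = x" if "x \<in> T" for x
    using a that by (auto simp: bij_betw_def inv_into_into f_inv_into_f)
  have bW: "b r \<in> V" "inv_into W b (b r) = r" if "r \<in> W" for r
    using b that by (auto simp: bij_betw_def)
  fix \<tau> assume \<tau>: "\<tau> \<in> Inj P W"
  then have \<tau>W: "\<tau> r \<in> W" if "r \<in> P" for r using that by (auto simp: Inj_def)
  show "(\<lambda>r\<in>P. inv_into W b ((\<lambda>x\<in>T. b (\<tau> (inv_into P a x))) (a r))) = \<tau>"
    using \<tau> by (auto simp: fun_eq_iff aP bW \<tau>W Inj_def PiE_def extensional_def)
  show "(\<lambda>x\<in>T. b (\<tau> (inv_into P a x))) \<in> Inj T V"
  proof -
    have "inj_on (\<lambda>x\<in>T. b (\<tau> (inv_into P a x))) T"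
    proof (rule inj_onI)
      fix x y assume xy: "x \<in> T" "y \<in> T"
        and "(\<lambda>x\<in>T. b (\<tau> (inv_into P a x))) x = (\<lambda>x\<in>T. b (\<tau> (inv_into P a x))) y"
      then have "inv_into W b (b (\<tau> (inv_into P a x))) = inv_into W b (b (\<tau> (inv_into P a y)))"
        by simp
      then have "\<tau> (inv_into P a x) = \<tau> (inv_into P a y)" using xy by (simp add: aT bW \<tau>W)
      then have "inv_into P a x = inv_into P a y"
        using \<tau> xy aT by (auto simp: Inj_def dest: inj_onD)
      then show "x = y" using xy aT(2) by metis
    qed
    then show ?thesis by (simp add: Inj_def aT bW \<tau>W)
  qed
qed

section \<open>The backward walk of \<open>star_map\<close> and its reversal\<close>

text \<open>In a finite \<open>S\<close> the backward walk from \<open>j\<close> must end: a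
  repeated point, pushed forward by \<open>\<phi>\<close>, would put \<open>j\<close> into
  \<open>S\<close>. Reversed, the walk is a forward path that first leaves \<open>S\<close> at
  \<open>j\<close>.\<close>

lemma star_map_return:
  assumes fin: "finite S" and j: "j \<in> \<phi> ` S - S"
  obtains L where "star_map S \<phi> j \<in> S - \<phi> ` S"
    and "(\<phi> ^^ L) (star_map S \<phi> j) = j"
    and "\<And>l. l < L \<Longrightarrow> (\<phi> ^^ l) (star_map S \<phi> j) \<in> S"
proof -
  define x where "x l = (inv_into S \<phi> ^^ l) j" for l
  have x0: "x 0 = j" and xS: "x (Suc l) = inv_into S \<phi> (x l)" for l by (simp_all add: x_def)
  \<comment> \<open>Before its end the walk can always continue: \<open>x 0 = j\<close> has a
    preimage by assumption, and a later \<open>x l\<close> lies in \<open>S\<close> without being an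
    end point.\<close>
  have pred: "x l \<in> \<phi> ` S \<and> x (Suc l) \<in> S \<and> \<phi> (x (Suc l)) = x l"
    if "\<And>i. i < L \<Longrightarrow> x i \<notin> S - \<phi> ` S" "l < L" for l L
    using that(2)
  proof (induction l)
    case 0
    then show ?case using j by (auto simp: x0 xS inv_into_into f_inv_into_f)
  next
    case (Suc l)
    then have "x (Suc l) \<in> \<phi> ` S" using that(1)[of "Suc l"] by auto
    then show ?case using xS[of "Suc l"] by (auto simp: inv_into_into f_inv_into_f)
  qed
  have fwd: "(\<phi> ^^ i) (x (l + i)) = x l"
    if "\<And>i. i < L \<Longrightarrow> x i \<notin> S - \<phi> ` S" "l + i \<le> L" for l i L
    using that(2)
  proof (induction i)
    case (Suc i)
    then have "\<phi> (x (Suc (l + i))) = x (l + i)" using pred[of L "l + i"] that(1) by simp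
    then show ?case using Suc by (simp add: funpow_swap1)
  qed simp
  have ex: "\<exists>l. x l \<in> S - \<phi> ` S"
  proof (rule ccontr)
    assume "\<not> ?thesis"
    then have no: "x i \<notin> S - \<phi> ` S" for i by blast
    have S: "x (Suc l) \<in> S" for l using pred[of "Suc l" l] no by blast
    have "x l \<in> insert j S" for l using S x0 by (metis insertCI not0_implies_Suc)
    then have "range x \<subseteq> insert j S" by blast
    then have "finite (range x)" using fin by (simp add: finite_subset)
    then have "\<not> inj x" using finite_imageD infinite_UNIV_nat by blast
    then obtain a b where ab: "a < b" "x a = x b"
      unfolding inj_def by (metis linorder_neqE_nat)
    \<comment> \<open>Applying \<open>\<phi>\<close> to the repetition \<open>a\<close> times yields
      \<open>x 0\<close> on one side; the other side has the positive index \<open>b - a\<close> and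
      hence lies in \<open>S\<close>, unlike \<open>j\<close>.\<close>
    have "x 0 = x (b - a)"
      using fwd[of a 0 a] fwd[of b "b - a" a] no ab by simp
    moreover obtain c where "b - a = Suc c" using ab(1) by (metis Suc_diff_Suc)
    ultimately show False using S[of c] j x0 by auto
  qed
  define L where "L = (LEAST l. x l \<in> S - \<phi> ` S)"
  have L: "x L \<in> S - \<phi> ` S" unfolding L_def using ex by (rule LeastI_ex)
  have before: "x i \<notin> S - \<phi> ` S" if "i < L" for i
    using that unfolding L_def by (rule not_less_Least)
  have star: "star_map S \<phi> j = x L" by (simp add: star_map_def L_def x_def)
  show thesis
  proof (rule that[of L])
    show "star_map S \<phi> j \<in> S - \<phi> ` S" using L star by simp
    show "(\<phi> ^^ L) (star_map S \<phi> j) = j" using fwd[of L 0 L] before star x0 by simp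
    fix l assume "l < L"
    \<comment> \<open>The index \<open>L - l\<close> is positive, so the point in question is a
      preimage chosen in \<open>S\<close> and not the start \<open>j\<close>.\<close>
    then have c: "L - l = Suc (L - Suc l)" "L - Suc l < L" by simp_all
    have "(\<phi> ^^ l) (star_map S \<phi> j) = x (L - l)"
      using fwd[of L "L - l" l] before star \<open>l < L\<close> by simp
    then show "(\<phi> ^^ l) (star_map S \<phi> j) \<in> S" using pred[of L "L - Suc l"] before c by simp
  qed
qed

text \<open>Off \<open>S\<close>, this is the index of the entry that \<open>bar_map\<close> places
  at \<open>j\<close>, with both cases of its rule in one map.\<close>

definition star_ext :: "'b set \<Rightarrow> ('b \<Rightarrow> 'b) \<Rightarrow> 'b \<Rightarrow> 'b" where
  "star_ext S \<phi> j = (if j \<in> \<phi> ` S then star_map S \<phi> j else j)"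

text \<open>A point outside the image of \<open>\<phi>\<close> is its own star, with the empty walk
  \<open>L = 0\<close>. In general \<open>L\<close> is the time of first exit from
  \<open>S\<close>.\<close>

lemma star_ext_return:
  assumes "finite S" and "j \<notin> S"
  obtains L where "star_ext S \<phi> j \<notin> \<phi> ` S"
    and "(\<phi> ^^ L) (star_ext S \<phi> j) = j"
    and "\<And>l. l < L \<Longrightarrow> (\<phi> ^^ l) (star_ext S \<phi> j) \<in> S"
proof (cases "j \<in> \<phi> ` S")
  case True
  then have e: "star_ext S \<phi> j = star_map S \<phi> j" by (simp add: star_ext_def)
  have "j \<in> \<phi> ` S - S" using True assms(2) by blast
  then obtain L where "star_map S \<phi> j \<in> S - \<phi> ` S" "(\<phi> ^^ L) (star_map S \<phi> j) = j"
      "\<And>l. l < L \<Longrightarrow> (\<phi> ^^ l) (star_map S \<phi> j) \<in> S"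
    using star_map_return[OF assms(1)] by blast
  then show thesis using that[of L] unfolding e by blast
next
  case False
  then show thesis using that[of 0] unfolding star_ext_def by simp
qed

text \<open>Injectivity: \<open>j\<close> is recovered as the first point outside \<open>S\<close> on the forward orbit of its
  image.\<close>

lemma bij_betw_star_ext:
  assumes fin: "finite V" and sub: "S \<subseteq> V" and \<phi>: "\<phi> \<in> Inj S V"
  shows "bij_betw (star_ext S \<phi>) (V - S) (V - \<phi> ` S)"
proof -
  have finS: "finite S" using fin sub finite_subset by blast
  have im: "\<phi> ` S \<subseteq> V" and inj: "inj_on \<phi> S" using \<phi> by (auto simp: Inj_def)
  have i: "inj_on (star_ext S \<phi>) (V - S)"
  proof (rule inj_onI)
    fix j k assume j: "j \<in> V - S" and k: "k \<in> V - S" and eq: "star_ext S \<phi> j = star_ext S \<phi> k"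
    obtain L where L: "(\<phi> ^^ L) (star_ext S \<phi> j) = j" "\<And>l. l < L \<Longrightarrow> (\<phi> ^^ l) (star_ext S \<phi> j) \<in> S"
      using star_ext_return[OF finS, of j \<phi>] j by blast
    obtain M where M: "(\<phi> ^^ M) (star_ext S \<phi> k) = k" "\<And>l. l < M \<Longrightarrow> (\<phi> ^^ l) (star_ext S \<phi> k) \<in> S"
      using star_ext_return[OF finS, of k \<phi>] k by blast
    \<comment> \<open>Were one walk shorter, its end point outside \<open>S\<close> would lie on the
      other walk before the exit, hence in \<open>S\<close>.\<close>
    have "\<not> L < M" using L(1) M(2)[of L] eq j by auto
    moreover have "\<not> M < L" using M(1) L(2)[of M] eq k by auto
    ultimately have "L = M" by simp
    then show "j = k" using L(1) M(1) eq by metis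
  qed
  have "star_ext S \<phi> j \<in> V - \<phi> ` S" if "j \<in> V - S" for j
  proof (cases "j \<in> \<phi> ` S")
    case True
    then have "j \<in> \<phi> ` S - S" using that by blast
    then have "star_map S \<phi> j \<in> S - \<phi> ` S" by (rule star_map_return[OF finS])
    then show ?thesis using True sub by (auto simp: star_ext_def)
  next
    case False
    then show ?thesis using that by (simp add: star_ext_def)
  qed
  then have "star_ext S \<phi> ` (V - S) \<subseteq> V - \<phi> ` S" by (rule image_subsetI)
  \<comment> \<open>As \<open>\<phi>\<close> is injective, both complements have the same size, so
    surjectivity follows by counting.\<close>
  moreover have "card (V - S) = card (V - \<phi> ` S)"
    using finS sub im inj by (simp add: card_Diff_subset card_image)
  moreover have "card (star_ext S \<phi> ` (V - S)) = card (V - S)" using i by (rule card_image)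
  ultimately have "star_ext S \<phi> ` (V - S) = V - \<phi> ` S"
    using fin by (intro card_subset_eq) simp_all
  then show ?thesis using i unfolding bij_betw_def by simp
qed

section \<open>Positions in the submatrix and original indices\<close>

text \<open>All indices from \<open>m\<close> on exceed those in \<open>N m - S\<close>. Hence equal
  row and column positions stand for the same original index, which is why reindexing respects
  cycles.\<close>

lemma sorted_list_of_set_prefix:
  assumes "S \<subseteq> N m" and "m \<le> n"
  shows "sorted_list_of_set (N n - S) = sorted_list_of_set (N m - S) @ [m..<n]"
proof -
  have "N n - S = (N m - S) \<union> {m..<n}" using assms by (auto simp: N_def)
  moreover have "card ((N m - S) \<union> {m..<n}) = card (N m - S) + card {m..<n}"
    by (rule card_Un_disjoint) (auto simp: N_def)
  ultimately have "sorted_wrt (<) (sorted_list_of_set (N m - S) @ [m..<n]) \<and>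
      set (sorted_list_of_set (N m - S) @ [m..<n]) = N n - S \<and>
      length (sorted_list_of_set (N m - S) @ [m..<n]) = card (N n - S)"
    by (auto simp: sorted_wrt_append N_def)
  then show ?thesis
    by (intro sorted_list_of_set_unique[THEN iffD1]) (simp add: N_def)
qed

lemma nth_bar_map:
  assumes S: "S \<subseteq> N n" and s: "s < card (N n - S)"
  shows "bar_map S \<phi> [0..<n] ! s = star_ext S \<phi> (sorted_list_of_set (N n - S) ! s)"
proof -
  let ?j = "sorted_list_of_set (N n - S) ! s"
  have fin: "finite S" "finite (N n - S)" using S by (auto simp: N_def finite_subset)
  have "?j \<in> set (sorted_list_of_set (N n - S))" using s by (intro nth_mem) simp
  then have j: "?j \<in> N n - S" using fin by simp
  \<comment> \<open>Looking up an index in \<open>[0..<n]\<close> returns that index only below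
    \<open>n\<close>.\<close>
  have "star_map S \<phi> ?j < n" if "?j \<in> \<phi> ` S"
  proof -
    have "?j \<in> \<phi> ` S - S" using that j by blast
    then have "star_map S \<phi> ?j \<in> S - \<phi> ` S" by (rule star_map_return[OF fin(1)])
    then show ?thesis using S by (auto simp: N_def)
  qed
  then show ?thesis using j s by (simp add: bar_map_def star_ext_def N_def)
qed

lemma funpow_cong_upto:
  assumes "\<And>i. i < l \<Longrightarrow> f ((g ^^ i) x) = g ((g ^^ i) x)"
  shows "(f ^^ l) x = (g ^^ l) x"
  using assms by (induction l) auto

text \<open>From \<open>\<psi> i\<close>, the star of \<open>\<sigma> i\<close>, the orbit follows
  \<open>\<phi>\<close> through \<open>S\<close>, where \<open>\<psi>\<close> agrees with it, and
  exits at \<open>\<sigma> i\<close>. So \<open>\<sigma>\<close> is the first-return map of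
  \<open>\<psi>\<close> on \<open>T\<close>.\<close>

lemma num_cycles_extension:
  assumes fin: "finite S" "finite T" and disj: "S \<inter> T = {}"
    and \<psi>S: "\<And>i. i \<in> S \<Longrightarrow> \<psi> i = \<phi> i"
    and \<psi>T: "\<And>i. i \<in> T \<Longrightarrow> \<psi> i = star_ext S \<phi> (\<sigma> i)"
    and out: "\<And>i. i \<in> T \<Longrightarrow> \<sigma> i \<notin> S"
  shows "num_cycles (S \<union> T) \<psi> = num_cycles S \<phi> + num_cycles T \<sigma>"
proof -
  have "\<exists>p. (\<psi> ^^ p) (\<psi> i) = \<sigma> i \<and> (\<forall>l<p. (\<psi> ^^ l) (\<psi> i) \<in> S)" if i: "i \<in> T" for i
  proof -
    obtain L where L: "(\<phi> ^^ L) (\<psi> i) = \<sigma> i" "\<And>l. l < L \<Longrightarrow> (\<phi> ^^ l) (\<psi> i) \<in> S"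
      using star_ext_return[OF fin(1) out[OF i]] \<psi>T[OF i] by metis
    have "(\<psi> ^^ l) (\<psi> i) = (\<phi> ^^ l) (\<psi> i)" if "l \<le> L" for l
      using L(2) \<psi>S that by (intro funpow_cong_upto) simp
    then show ?thesis using L by (intro exI[of _ L]) simp
  qed
  then have "num_cycles (S \<union> T) \<psi> = num_cycles S \<psi> + num_cycles T \<sigma>"
    using fin disj out by (intro num_cycles_first_return)
  then show ?thesis using num_cycles_cong[of S \<psi> \<phi>] \<psi>S by simp
qed

text \<open>The terms of \<open>per(z; A)\<close> whose restriction to \<open>S\<close> is \<open>\<phi>\<close>.\<close>

lemma cyc_per_fibre:
  fixes A :: "'a::comm_ring_1 mat" and z :: 'a
  assumes S: "S \<subseteq> N m" and mn: "m \<le> n" and \<phi>: "\<phi> \<in> Inj S (N n)"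
  shows "(\<Sum>\<chi>\<in>Inj (N m - S) (N n - \<phi> ` S).
      z ^ num_cycles (N m) (\<lambda>i. if i \<in> S then \<phi> i else \<chi> i) *
      (\<Prod>i\<in>N m. A $$ (i, if i \<in> S then \<phi> i else \<chi> i))) =
    z ^ num_cycles S \<phi> * (\<Prod>i\<in>S. A $$ (i, \<phi> i)) *
      cyc_per z (select_mat A (N m - S) (bar_map S \<phi> [0..<n]))"
proof -
  let ?T = "N m - S" and ?U = "N n - S"
  define p q where "p = card ?T" and "q = card ?U"
  \<comment> \<open>One enumeration serves rows and columns: the first \<open>p\<close> values of
    \<open>h\<close> run through \<open>?T\<close>.\<close>
  define h where "h = (!) (sorted_list_of_set ?U)"
  have fin: "finite S" "finite ?T" "finite ?U" "finite (N n)"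
    using S by (auto simp: N_def finite_subset)
  have Sn: "S \<subseteq> N n" using S mn by (auto simp: N_def)
  have hT: "sorted_list_of_set ?T ! r = h r" if "r < p" for r
    using that by (simp add: h_def p_def sorted_list_of_set_prefix[OF S mn] nth_append)
  have pq: "p \<le> q" unfolding p_def q_def
    using fin mn by (intro card_mono) (auto simp: N_def)
  have hU: "bij_betw h (N q) ?U"
    unfolding h_def using fin by (intro bij_betw_nth) (auto simp: N_def q_def)
  have "bij_betw (\<lambda>r. sorted_list_of_set ?T ! r) (N p) ?T"
    using fin by (intro bij_betw_nth) (auto simp: N_def p_def)
  then have hP: "bij_betw h (N p) ?T"
    using hT by (subst bij_betw_cong[where g = "(!) (sorted_list_of_set ?T)"]) (auto simp: N_def)
  \<comment> \<open>Column \<open>s\<close> of the submatrix is column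
    \<open>star_ext S \<phi> (h s)\<close> of \<open>A\<close>; these are exactly the columns not
    hit by \<open>\<phi>\<close>.\<close>
  have b: "bij_betw (star_ext S \<phi> \<circ> h) (N q) (N n - \<phi> ` S)"
    using hU bij_betw_star_ext[OF fin(4) Sn \<phi>] by (rule bij_betw_trans)
  have summand: "z ^ num_cycles (N m) (\<lambda>i. if i \<in> S then \<phi> i else
        (\<lambda>x\<in>?T. (star_ext S \<phi> \<circ> h) (\<tau> (inv_into (N p) h x))) i) *
      (\<Prod>i\<in>N m. A $$ (i, if i \<in> S then \<phi> i else
        (\<lambda>x\<in>?T. (star_ext S \<phi> \<circ> h) (\<tau> (inv_into (N p) h x))) i)) =
      z ^ num_cycles S \<phi> * (\<Prod>i\<in>S. A $$ (i, \<phi> i)) *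
      (z ^ num_cycles (N p) \<tau> * (\<Prod>r\<in>N p. A $$ (h r, star_ext S \<phi> (h (\<tau> r)))))"
    (is "z ^ num_cycles (N m) ?\<psi> * ?lhs = _") if \<tau>: "\<tau> \<in> Inj (N p) (N q)" for \<tau>
  proof -
    \<comment> \<open>\<open>\<sigma>\<close> is \<open>\<tau>\<close> carried by \<open>h\<close>
      from positions to original indices; on \<open>?T\<close> the glued map \<open>?\<psi>\<close>
      is \<open>star_ext S \<phi>\<close> after \<open>\<sigma>\<close>.\<close>
    define \<sigma> where "\<sigma> x = h (\<tau> (inv_into (N p) h x))" for x
    have \<tau>q: "\<tau> r \<in> N q" if "r \<in> N p" for r using \<tau> that by (auto simp: Inj_def)
    have \<sigma>h: "\<sigma> (h r) = h (\<tau> r)" if "r \<in> N p" for r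
      using hP that by (simp add: \<sigma>_def bij_betw_def)
    have Nm: "S \<union> ?T = N m" using S by blast
    have \<sigma>_out: "\<sigma> i \<in> ?U" if "i \<in> ?T" for i
    proof -
      have "i \<in> h ` N p" using hP that by (simp add: bij_betw_def)
      then obtain r where "r \<in> N p" "i = h r" by blast
      then show ?thesis using \<sigma>h \<tau>q bij_betwE[OF hU] by simp
    qed
    have "num_cycles (S \<union> ?T) ?\<psi> = num_cycles S \<phi> + num_cycles ?T \<sigma>"
    proof (rule num_cycles_extension)
      fix i assume "i \<in> ?T"
      then show "\<sigma> i \<notin> S" using \<sigma>_out by blast
    qed (use fin in \<open>auto simp: \<sigma>_def\<close>)
    moreover have "num_cycles (h ` N p) \<sigma> = num_cycles (N p) \<tau>"
    proof (rule num_cycles_relabel)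
      \<comment> \<open>\<open>\<tau>\<close> may leave \<open>N p\<close>, but by
        \<open>p \<le> q\<close> everything stays in \<open>N q\<close>, where \<open>h\<close> is
        injective.\<close>
      have "N p \<union> \<tau> ` N p \<subseteq> N q" using pq \<tau>q by (auto simp: N_def)
      then show "inj_on h (N p \<union> \<tau> ` N p)" using hU by (auto simp: bij_betw_def intro: inj_on_subset)
    qed (rule \<sigma>h)
    ultimately have cyc: "num_cycles (N m) ?\<psi> = num_cycles S \<phi> + num_cycles (N p) \<tau>"
      using hP Nm by (simp add: bij_betw_def)
    have "?lhs = (\<Prod>i\<in>S \<union> ?T. A $$ (i, ?\<psi> i))" unfolding Nm ..
    also have "\<dots> = (\<Prod>i\<in>S. A $$ (i, ?\<psi> i)) * (\<Prod>i\<in>?T. A $$ (i, ?\<psi> i))"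
      using fin by (intro prod.union_disjoint) auto
    also have "(\<Prod>i\<in>S. A $$ (i, ?\<psi> i)) = (\<Prod>i\<in>S. A $$ (i, \<phi> i))" by simp
    also have "(\<Prod>i\<in>?T. A $$ (i, ?\<psi> i)) = (\<Prod>i\<in>?T. A $$ (i, star_ext S \<phi> (\<sigma> i)))"
      by (intro prod.cong) (auto simp: \<sigma>_def)
    also have "\<dots> = (\<Prod>r\<in>N p. A $$ (h r, star_ext S \<phi> (\<sigma> (h r))))"
      using hP by (rule prod.reindex_bij_betw[symmetric])
    also have "\<dots> = (\<Prod>r\<in>N p. A $$ (h r, star_ext S \<phi> (h (\<tau> r))))"
      by (simp add: \<sigma>h)
    finally show ?thesis by (simp add: cyc power_add mult_ac)
  qed
  have len: "length (bar_map S \<phi> [0..<n]) = q" by (simp add: bar_map_def q_def)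
  have entry: "select_mat A ?T (bar_map S \<phi> [0..<n]) $$ (r, \<tau> r) = A $$ (h r, star_ext S \<phi> (h (\<tau> r)))"
    if "\<tau> \<in> Inj (N p) (N q)" "r \<in> N p" for \<tau> r
  proof -
    have "r < p" "\<tau> r < q" using that by (auto simp: Inj_def N_def)
    then show ?thesis
      using nth_bar_map[OF Sn, of "\<tau> r" \<phi>] hT[of r]
      by (simp add: select_mat_def len flip: p_def q_def h_def)
  qed
  have "cyc_per z (select_mat A ?T (bar_map S \<phi> [0..<n])) =
    (\<Sum>\<tau>\<in>Inj (N p) (N q). z ^ num_cycles (N p) \<tau> *
      (\<Prod>r\<in>N p. A $$ (h r, star_ext S \<phi> (h (\<tau> r)))))"
  proof -
    have "dim_row (select_mat A ?T (bar_map S \<phi> [0..<n])) = p"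
      "dim_col (select_mat A ?T (bar_map S \<phi> [0..<n])) = q"
      by (simp_all add: select_mat_def len p_def)
    then show ?thesis by (simp add: cyc_per_def entry cong: sum.cong prod.cong)
  qed
  \<comment> \<open>The sum over \<open>\<chi>\<close> becomes a sum over \<open>\<tau>\<close>,
    from which the factors depending only on \<open>\<phi>\<close> are pulled out.\<close>
  then show ?thesis
    unfolding sum_Inj_relabel[OF hP b] by (simp add: summand sum_distrib_left cong: sum.cong)
qed

theorem theorem4:
  fixes A :: "'a::comm_ring_1 mat" and z :: 'a and m n k :: nat and \<beta> :: "nat list"
  assumes "A \<in> carrier_mat m n" and "m \<le> n"
    and "1 \<le> k" and "k \<le> m - 1" and "\<beta> \<in> Q k m"
  shows "cyc_per z A =
    (\<Sum>\<phi>\<in>Inj (set \<beta>) (N n).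
       z ^ num_cycles (set \<beta>) \<phi> * (\<Prod>i\<in>set \<beta>. A $$ (i, \<phi> i)) *
       cyc_per z (select_mat A (N m - set \<beta>) (bar_map (set \<beta>) \<phi> [0..<n])))"
proof -
  have S: "set \<beta> \<subseteq> N m" using assms(5) by (simp add: Q_def)
  have dims: "dim_row A = m" "dim_col A = n" using assms(1) by auto
  have "Inj (N m) (N n) = Inj (set \<beta> \<union> (N m - set \<beta>)) (N n)" using S by (simp add: Un_absorb1)
  then have "cyc_per z A = (\<Sum>\<psi>\<in>Inj (set \<beta> \<union> (N m - set \<beta>)) (N n).
      z ^ num_cycles (N m) \<psi> * (\<Prod>i\<in>N m. A $$ (i, \<psi> i)))"
    by (simp add: cyc_per_def dims)
  also have "\<dots> = (\<Sum>\<phi>\<in>Inj (set \<beta>) (N n). \<Sum>\<chi>\<in>Inj (N m - set \<beta>) (N n - \<phi> ` set \<beta>).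
      z ^ num_cycles (N m) (\<lambda>i. if i \<in> set \<beta> then \<phi> i else \<chi> i) *
      (\<Prod>i\<in>N m. A $$ (i, if i \<in> set \<beta> then \<phi> i else \<chi> i)))"
    by (rule sum_Inj_Un) (auto simp: N_def)
  also have "\<dots> = (\<Sum>\<phi>\<in>Inj (set \<beta>) (N n).
       z ^ num_cycles (set \<beta>) \<phi> * (\<Prod>i\<in>set \<beta>. A $$ (i, \<phi> i)) *
       cyc_per z (select_mat A (N m - set \<beta>) (bar_map (set \<beta>) \<phi> [0..<n])))"
    by (intro sum.cong refl cyc_per_fibre[OF S assms(2)])
  finally show ?thesis .
qed

end
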